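(* Let $(A,L,[\cdot,\cdot],\rho)$ be a Lie-Rinehart superalgebra over a field $\mathbb{K}$ of characteristic zero, and let $m=[\cdot,\cdot]\in\mathrm{Der}^1(L,L)$, with symbol map $\rho$. For a deformation $m_t=\sum_{i\ge 0} t^im_i$ of $m$, the cohomology class of the infinitesimal element $m_1$ is determined by the equivalence class of $m_t$; that is, if $m_t=\sum_{i\ge 0} t^im_i$ and $m'_t=\sum_{i\ge 0} t^im'_i$ are equivalent deformations of $m$, then $\overline{m_1}=\overline{m'_1}$ in $H^2_{def}(L)$.
   Context: $|x|\in\mathbb{Z}_2$ denotes the degree of a homogeneous element; identities involving degrees are for homogeneous elements. A superderivation of $A$ of degree $|D|$ is a homogeneous linear map $D:A\to A$ with $D(ab)=D(a)b+(-1)^{|a||D|}aD(b)$; $\mathrm{Der}(A)$ is the Lie superalgebra of superderivations with the supercommutator. A Lie-Rinehart superalgebra $(A,L,[\cdot,\cdot],\rho)$ over $\mathbb{K}$ consists of an associative supercommutative $\mathbb{K}$-superalgebra $A$, a Lie superalgebra $L$ over $\mathbb{K}$ (bracket with $|[x,y]|=|x|+|y|$, $[x,y]=-(-1)^{|x||y|}[y,x]$, $[x,[y,z]]=[[x,y],z]+(-1)^{|x||y|}[y,[x,z]]$), an $A$-module structure on $L$ with $|ax|=|a|+|x|$, and an even Lie superalgebra morphism $\rho:L\to\mathrm{Der}(A)$ with $[x,ay]=\rho(x)(a)y+(-1)^{|a||x|}a[x,y]$ and $\rho(ax)(b)=a\rho(x)(b)$. For $n\ge 0$, $\mathrm{Der}^n(L,L)$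 is the space of multilinear maps $f:L^{\times(n+1)}\to L$ for which there exists a map $\sigma_f:L^{\otimes n}\to\mathrm{Der}(A)$ (symbol map) such that: (1) $f(x_1,\dots,x_i,x_{i+1},\dots,x_{n+1})=-(-1)^{|x_i||x_{i+1}|}f(x_1,\dots,x_{i+1},x_i,\dots,x_{n+1})$ for $1\le i\le n$; (2) $f(x_1,\dots,x_n,ax_{n+1})=(-1)^{|a|(|f|+|x_1|+\cdots+|x_n|)}af(x_1,\dots,x_{n+1})+\sigma_f(x_1,\dots,x_n)(a)x_{n+1}$ for all $a\in A$. Here $|f|=j$ means $|f(x_1,\dots,x_{n+1})|-\sum_i|x_i|=j$ mod 2. Also $\mathrm{Der}^{-1}(L,L)=L$. For $f\in\mathrm{Der}^p(L,L)$, $g\in\mathrm{Der}^q(L,L)$, set \[(f\circ g)(x_1,\dots,x_{p+q+1})=\sum_{\tau}\varepsilon(\tau,x_1,\dots,x_{p+q+1})\,f\big(g(x_{\tau(1)},\dots,x_{\tau(q+1)}),x_{\tau(q+2)},\dots,x_{\tau(p+q+1)}\big),\] summing over permutations $\tau$ of $\{1,\dots,p+q+1\}$ with $\tau(1)<\cdots<\tau(q+1)$ and $\tau(q+2)<\cdots<\tau(p+q+1)$, where $\varepsilon$ is $\mathrm{sgn}(\tau)$ times the Koszul sign of the permutation of the homogeneous $x_i$. The bracket is $[f,g]=f\circ g-(-1)^{pq}g\circ f$. The deformation complex is $C^n_{def}(L,L)=\mathrm{Der}^{n-1}(L,L)$ ($n\ge 0$) with differential $\delta D=[m,D]$; $Z^n_{def}(L)$,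 $B^n_{def}(L)$ are its $n$-cocycles and $n$-coboundaries, $H^n_{def}(L)=Z^n_{def}(L)/B^n_{def}(L)$, and $\overline{\mu}$ is the class of $\mu\in Z^2_{def}(L)$. A deformation of $m$ is a $\mathbb{K}[[t]]$-bilinear map $m_t:L\times L\to L[[t]]$, $m_t(x,y)=\sum_{i\ge0}t^im_i(x,y)$ (extended to $L[[t]]\times L[[t]]$ by $\mathbb{K}[[t]]$-bilinearity), with $m_0=m$, $m_i\in\mathrm{Der}^1(L,L)$ for $i\ge1$, and $[m_t,m_t]=0$, the bracket being the one above on $\mathrm{Der}^*(L[[t]],L[[t]])$. In any deformation, $m_1\in Z^2_{def}(L)$. Two deformations $m_t,m'_t$ of $m$ are equivalent if there is an even formal automorphism $\Phi_t=\mathrm{id}+\sum_{i\ge1}t^i\phi_i$ of $L[[t]]$, with $\phi_i:L\to L$ even $\mathbb{K}$-linear maps, such that $\Phi_t(m'_t(x,y))=m_t(\Phi_t(x),\Phi_t(y))$.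
   Formalization: The formal automorphism Φ_t is also required to respect the A[[t]]-module structure: Φ_t(aX)=ψ_t(a)Φ_t(X) for an even algebra automorphism ψ_t=id+Σt^iψ_i of A[[t]]; for merely K-linear φ_i the claim is false. *)

theory Defs
  imports
    "HOL-Library.Z2"
    "HOL-Combinatorics.Permutations"
    "HOL-Computational_Algebra.Formal_Power_Series"
begin

section \<open>Super vector spaces\<close>

text \<open>Degrees live in the two-element field \<^typ>\<open>bit\<close>, so that the exponent of a sign such as
  \<open>(-1)^(|a||b|)\<close> is the \<^typ>\<open>bit\<close> product of the degrees.\<close>

definition ksign :: "bit \<Rightarrow> 'k::ring_1" where
  "ksign d = (if d = 1 then - 1 else 1)"

locale super_space = vector_space scale
  for scale :: "'k::field \<Rightarrow> 'v::ab_group_add \<Rightarrow> 'v" +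
  fixes gr :: "bit \<Rightarrow> 'v set"
  assumes subspace_gr: "subspace (gr d)"
    and gr_Int: "gr 0 \<inter> gr 1 = {0}"
    and gr_sum: "\<exists>u\<in>gr 0. \<exists>w\<in>gr 1. x = u + w"

text \<open>The homogeneous component of degree \<open>d\<close>; in \<^typ>\<open>bit\<close>, \<open>d + 1\<close> is the other degree.\<close>

definition component :: "(bit \<Rightarrow> 'v::ab_group_add set) \<Rightarrow> bit \<Rightarrow> 'v \<Rightarrow> 'v" where
  "component gr d x = (THE y. y \<in> gr d \<and> x - y \<in> gr (d + 1))"

definition homogeneous_list :: "(bit \<Rightarrow> 'v set) \<Rightarrow> bit list \<Rightarrow> 'v list \<Rightarrow> bool" where
  "homogeneous_list gr ds xs \<longleftrightarrow> list_all2 (\<lambda>d x. x \<in> gr d) ds xs"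

definition even_linear ::
  "('k::field \<Rightarrow> 'v::ab_group_add \<Rightarrow> 'v) \<Rightarrow> (bit \<Rightarrow> 'v set) \<Rightarrow> ('v \<Rightarrow> 'v) \<Rightarrow> bool" where
  "even_linear s gr f \<longleftrightarrow> Vector_Spaces.linear s s f \<and> (\<forall>d. f ` gr d \<subseteq> gr d)"

text \<open>An \<open>n\<close>-ary map is a function on lists, of which only the values on lists of length \<open>n\<close> matter.\<close>

definition multilinear_map ::
  "('k::field \<Rightarrow> 'v::ab_group_add \<Rightarrow> 'v) \<Rightarrow> ('k \<Rightarrow> 'w::ab_group_add \<Rightarrow> 'w) \<Rightarrow> nat
    \<Rightarrow> ('v list \<Rightarrow> 'w) \<Rightarrow> bool" where
  "multilinear_map s s' n f \<longleftrightarrow>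
    (\<forall>xs i. length xs = n \<and> i < n \<longrightarrow> Vector_Spaces.linear s s' (\<lambda>x. f (xs[i := x])))"

section \<open>Lie-Rinehart superalgebras\<close>

text \<open>Superderivations of \<open>A\<close> of degree \<open>d\<close>, and the space they span.\<close>

definition superderivations ::
  "('k::field \<Rightarrow> 'a::ring \<Rightarrow> 'a) \<Rightarrow> (bit \<Rightarrow> 'a set) \<Rightarrow> bit \<Rightarrow> ('a \<Rightarrow> 'a) set" where
  "superderivations s gr d =
    {D. Vector_Spaces.linear s s D \<and> (\<forall>e. D ` gr e \<subseteq> gr (d + e)) \<and>
        (\<forall>e. \<forall>a\<in>gr e. \<forall>b. D (a * b) = D a * b + s (ksign (e * d)) (a * D b))}"

definition Der ::
  "('k::field \<Rightarrow> 'a::ring \<Rightarrow> 'a) \<Rightarrow> (bit \<Rightarrow> 'a set) \<Rightarrow> ('a \<Rightarrow> 'a) set" where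
  "Der s gr = {\<lambda>a. D a + E a |D E. D \<in> superderivations s gr 0 \<and> E \<in> superderivations s gr 1}"

record ('k, 'a, 'l) lr_data =
  scaleA :: "'k \<Rightarrow> 'a \<Rightarrow> 'a"
  grA :: "bit \<Rightarrow> 'a set"
  scaleL :: "'k \<Rightarrow> 'l \<Rightarrow> 'l"
  grL :: "bit \<Rightarrow> 'l set"
  act :: "'a \<Rightarrow> 'l \<Rightarrow> 'l"
  lie :: "'l \<Rightarrow> 'l \<Rightarrow> 'l"
  anchor :: "'l \<Rightarrow> 'a \<Rightarrow> 'a"

text \<open>The superalgebra \<open>A\<close> is not assumed to have a unit.\<close>

locale lie_rinehart_superalgebra =
  fixes R :: "('k::field, 'a::ring, 'l::ab_group_add) lr_data"
  assumes super_A: "super_space (scaleA R) (grA R)"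
    and super_L: "super_space (scaleL R) (grL R)"
    \<comment> \<open>\<open>A\<close> is a supercommutative superalgebra (associativity is part of class \<open>ring\<close>)\<close>
    and mult_linear_left: "\<And>b. Vector_Spaces.linear (scaleA R) (scaleA R) (\<lambda>a. a * b)"
    and mult_linear_right: "\<And>a. Vector_Spaces.linear (scaleA R) (scaleA R) (\<lambda>b. a * b)"
    and mult_degree: "a \<in> grA R d \<Longrightarrow> b \<in> grA R e \<Longrightarrow> a * b \<in> grA R (d + e)"
    and supercommute:
      "a \<in> grA R d \<Longrightarrow> b \<in> grA R e \<Longrightarrow> a * b = scaleA R (ksign (d * e)) (b * a)"
    \<comment> \<open>\<open>L\<close> is a Lie superalgebra\<close>
    and lie_linear_left: "\<And>y. Vector_Spaces.linear (scaleL R) (scaleL R) (\<lambda>x. lie R x y)"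
    and lie_linear_right: "\<And>x. Vector_Spaces.linear (scaleL R) (scaleL R) (\<lambda>y. lie R x y)"
    and lie_degree: "x \<in> grL R d \<Longrightarrow> y \<in> grL R e \<Longrightarrow> lie R x y \<in> grL R (d + e)"
    and lie_skew:
      "x \<in> grL R d \<Longrightarrow> y \<in> grL R e \<Longrightarrow> lie R x y = - scaleL R (ksign (d * e)) (lie R y x)"
    and lie_jacobi:
      "x \<in> grL R d \<Longrightarrow> y \<in> grL R e \<Longrightarrow> z \<in> grL R c \<Longrightarrow>
        lie R x (lie R y z) =
          lie R (lie R x y) z + scaleL R (ksign (d * e)) (lie R y (lie R x z))"
    \<comment> \<open>\<open>L\<close> is an \<open>A\<close>-module\<close>
    and act_linear_left: "\<And>x. Vector_Spaces.linear (scaleA R) (scaleL R) (\<lambda>a. act R a x)"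
    and act_linear_right: "\<And>a. Vector_Spaces.linear (scaleL R) (scaleL R) (\<lambda>x. act R a x)"
    and act_mult: "act R (a * b) x = act R a (act R b x)"
    and act_degree: "a \<in> grA R d \<Longrightarrow> x \<in> grL R e \<Longrightarrow> act R a x \<in> grL R (d + e)"
    \<comment> \<open>\<open>anchor\<close> is an even morphism of Lie superalgebras from \<open>L\<close> to \<open>Der(A)\<close>\<close>
    and anchor_linear: "\<And>a. Vector_Spaces.linear (scaleL R) (scaleA R) (\<lambda>x. anchor R x a)"
    and anchor_degree:
      "x \<in> grL R d \<Longrightarrow> anchor R x \<in> superderivations (scaleA R) (grA R) d"
    and anchor_lie:
      "x \<in> grL R d \<Longrightarrow> y \<in> grL R e \<Longrightarrow>
        anchor R (lie R x y) a =
          anchor R x (anchor R y a) - scaleA R (ksign (d * e)) (anchor R y (anchor R x a))"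
    \<comment> \<open>compatibility\<close>
    and leibniz:
      "x \<in> grL R d \<Longrightarrow> a \<in> grA R e \<Longrightarrow>
        lie R x (act R a y) =
          act R (anchor R x a) y + scaleL R (ksign (e * d)) (act R a (lie R x y))"
    and anchor_act: "anchor R (act R a x) b = a * anchor R x b"

section \<open>The deformation complex\<close>

text \<open>\<open>Der_LL_hom R n j\<close> are the homogeneous elements of degree \<open>j\<close> of \<open>Der\<^sup>n(L,L)\<close>, for
  \<open>n \<ge> 0\<close>: maps of \<open>n + 1\<close> arguments, normalised to vanish on lists of any other length so that
  equality of cochains is equality of functions. Condition (2) involves \<open>|f|\<close>, so it is stated
  for homogeneous \<open>f\<close>, and \<open>Der\<^sup>n(L,L)\<close> is the span of these.\<close>

definition Der_LL_hom ::
  "('k::field, 'a::ring, 'l::ab_group_add) lr_data \<Rightarrow> nat \<Rightarrow> bit \<Rightarrow> ('l list \<Rightarrow> 'l) set" where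
  "Der_LL_hom R n j = {f.
    (\<forall>xs. length xs \<noteq> n + 1 \<longrightarrow> f xs = 0) \<and>
    multilinear_map (scaleL R) (scaleL R) (n + 1) f \<and>
    (\<forall>ds xs. length xs = n + 1 \<and> homogeneous_list (grL R) ds xs
       \<longrightarrow> f xs \<in> grL R (j + sum_list ds)) \<and>
    (\<forall>ds xs i. length xs = n + 1 \<and> homogeneous_list (grL R) ds xs \<and> i < n
       \<longrightarrow> f xs = - scaleL R (ksign (ds ! i * ds ! (i + 1)))
                     (f (xs[i := xs ! (i + 1), i + 1 := xs ! i]))) \<and>
    (\<exists>\<sigma> :: 'l list \<Rightarrow> 'a \<Rightarrow> 'a.
       (\<forall>xs. length xs = n \<longrightarrow> \<sigma> xs \<in> Der (scaleA R) (grA R)) \<and>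
       (\<forall>a. multilinear_map (scaleL R) (scaleA R) n (\<lambda>xs. \<sigma> xs a)) \<and>
       (\<forall>ds xs y e a. length xs = n \<and> homogeneous_list (grL R) ds xs \<and> a \<in> grA R e
          \<longrightarrow> f (xs @ [act R a y]) =
                scaleL R (ksign (e * (j + sum_list ds))) (act R a (f (xs @ [y])))
                + act R (\<sigma> xs a) y))}"

definition Der_LL ::
  "('k::field, 'a::ring, 'l::ab_group_add) lr_data \<Rightarrow> nat \<Rightarrow> ('l list \<Rightarrow> 'l) set" where
  "Der_LL R n = {\<lambda>xs. f xs + g xs |f g. f \<in> Der_LL_hom R n 0 \<and> g \<in> Der_LL_hom R n 1}"

text \<open>\<open>C\<^sup>n = Der\<^sup>n\<^sup>-\<^sup>1(L,L)\<close> consists of maps of \<open>n\<close> arguments; an element of \<open>C\<^sup>0 = L\<close> is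
  encoded by its value on the empty list.\<close>

definition def_cochains :: "('k::field, 'a::ring, 'l::ab_group_add) lr_data \<Rightarrow> nat \<Rightarrow> ('l list \<Rightarrow> 'l) set"
  where "def_cochains R n = (case n of 0 \<Rightarrow> {f. \<forall>xs. xs \<noteq> [] \<longrightarrow> f xs = 0} | Suc p \<Rightarrow> Der_LL R p)"

text \<open>Koszul sign of the rearrangement of \<open>N\<close> homogeneous elements with list of degrees \<open>ds\<close>
  into the order \<open>\<tau> 0, \<dots>, \<tau> (N - 1)\<close>.\<close>

definition koszul_sign :: "(nat \<Rightarrow> nat) \<Rightarrow> bit list \<Rightarrow> 'k::comm_ring_1" where
  "koszul_sign \<tau> ds =
    (\<Prod>(i, j) \<in> {(i, j). i < j \<and> j < length ds \<and> \<tau> j < \<tau> i}. ksign (ds ! \<tau> i * ds ! \<tau> j))"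

definition shuffles_of :: "nat \<Rightarrow> nat \<Rightarrow> (nat \<Rightarrow> nat) set" where
  "shuffles_of b N =
    {\<tau>. \<tau> permutes {..<N} \<and> strict_mono_on {..<b} \<tau> \<and> strict_mono_on {b..<N} \<tau>}"

text \<open>\<open>circ s gr a b f g\<close> is \<open>f \<circ> g\<close> for \<open>f\<close> of \<open>a = p + 1\<close> and \<open>g\<close> of \<open>b = q + 1\<close> arguments; the
  result has \<open>a + b - 1 = p + q + 1\<close> arguments. The defining formula is for homogeneous arguments;
  arbitrary arguments are decomposed into homogeneous components, \<open>ds\<close> running over all choices of
  their degrees. For \<open>a = 0\<close>, i.e. \<open>f \<in> L\<close>, there is nothing to insert \<open>g\<close> into and \<open>f \<circ> g = 0\<close>.\<close>

definition circ ::
  "('k::field \<Rightarrow> 'l::ab_group_add \<Rightarrow> 'l) \<Rightarrow> (bit \<Rightarrow> 'l set) \<Rightarrow> nat \<Rightarrow> nat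
    \<Rightarrow> ('l list \<Rightarrow> 'l) \<Rightarrow> ('l list \<Rightarrow> 'l) \<Rightarrow> 'l list \<Rightarrow> 'l" where
  "circ s gr a b f g xs =
    (let N = a + b - 1 in
     if a = 0 \<or> length xs \<noteq> N then 0
     else \<Sum>ds\<in>{ds. length ds = N}. \<Sum>\<tau>\<in>shuffles_of b N.
       (let ys = map2 (component gr) ds xs in
        s (of_int (sign \<tau>) * koszul_sign \<tau> ds)
          (f (g (map (\<lambda>i. ys ! \<tau> i) [0..<b]) # map (\<lambda>i. ys ! \<tau> i) [b..<N]))))"

text \<open>With \<open>p = a - 1\<close> and \<open>q = b - 1\<close>, the sign \<open>(-1)^(pq)\<close> is \<open>(-1)^((a+1)(b+1))\<close>.\<close>

definition cochain_bracket ::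
  "('k::field \<Rightarrow> 'l::ab_group_add \<Rightarrow> 'l) \<Rightarrow> (bit \<Rightarrow> 'l set) \<Rightarrow> nat \<Rightarrow> nat
    \<Rightarrow> ('l list \<Rightarrow> 'l) \<Rightarrow> ('l list \<Rightarrow> 'l) \<Rightarrow> 'l list \<Rightarrow> 'l" where
  "cochain_bracket s gr a b f g xs =
    circ s gr a b f g xs - s ((- 1) ^ ((a + 1) * (b + 1))) (circ s gr b a g f xs)"

definition lie_cochain :: "('k, 'a, 'l::zero) lr_data \<Rightarrow> 'l list \<Rightarrow> 'l" where
  "lie_cochain R xs = (if length xs = 2 then lie R (xs ! 0) (xs ! 1) else 0)"

definition def_differential ::
  "('k::field, 'a, 'l::ab_group_add) lr_data \<Rightarrow> nat \<Rightarrow> ('l list \<Rightarrow> 'l) \<Rightarrow> 'l list \<Rightarrow> 'l" where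
  "def_differential R n D = cochain_bracket (scaleL R) (grL R) 2 n (lie_cochain R) D"

definition def_cocycles :: "('k::field, 'a::ring, 'l::ab_group_add) lr_data \<Rightarrow> nat \<Rightarrow> ('l list \<Rightarrow> 'l) set"
  where "def_cocycles R n = {D \<in> def_cochains R n. def_differential R n D = (\<lambda>_. 0)}"

definition def_coboundaries :: "('k::field, 'a::ring, 'l::ab_group_add) lr_data \<Rightarrow> nat \<Rightarrow> ('l list \<Rightarrow> 'l) set"
  where "def_coboundaries R n = (case n of 0 \<Rightarrow> {\<lambda>_. 0} | Suc k \<Rightarrow> def_differential R k ` def_cochains R k)"

definition cohomologous ::
  "('k::field, 'a::ring, 'l::ab_group_add) lr_data \<Rightarrow> nat \<Rightarrow> (('l list \<Rightarrow> 'l) \<times> ('l list \<Rightarrow> 'l)) set"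
  where "cohomologous R n =
    {(\<mu>, \<nu>). \<mu> \<in> def_cocycles R n \<and> \<nu> \<in> def_cocycles R n \<and> (\<lambda>xs. \<mu> xs - \<nu> xs) \<in> def_coboundaries R n}"

definition def_cohomology ::
  "('k::field, 'a::ring, 'l::ab_group_add) lr_data \<Rightarrow> nat \<Rightarrow> ('l list \<Rightarrow> 'l) set set"
  where "def_cohomology R n = def_cocycles R n // cohomologous R n"

definition cohomology_class ::
  "('k::field, 'a::ring, 'l::ab_group_add) lr_data \<Rightarrow> nat \<Rightarrow> ('l list \<Rightarrow> 'l) \<Rightarrow> ('l list \<Rightarrow> 'l) set"
  where "cohomology_class R n \<mu> = cohomologous R n `` {\<mu>}"

section \<open>Formal deformations\<close>

text \<open>\<open>A[[t]]\<close> and \<open>L[[t]]\<close> are the types \<^typ>\<open>'a fps\<close> and \<^typ>\<open>'l fps\<close>, graded and scaled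
  coefficientwise.\<close>

definition gr_fps :: "(bit \<Rightarrow> 'v::zero set) \<Rightarrow> bit \<Rightarrow> 'v fps set" where
  "gr_fps gr d = {X. \<forall>n. fps_nth X n \<in> gr d}"

definition scale_fps :: "('k \<Rightarrow> 'v::zero \<Rightarrow> 'v) \<Rightarrow> 'k \<Rightarrow> 'v fps \<Rightarrow> 'v fps" where
  "scale_fps s c X = Abs_fps (\<lambda>n. s c (fps_nth X n))"

definition act_fps ::
  "('k, 'a::zero, 'l::ab_group_add) lr_data \<Rightarrow> 'a fps \<Rightarrow> 'l fps \<Rightarrow> 'l fps" where
  "act_fps R \<alpha> X = Abs_fps (\<lambda>n. \<Sum>i\<le>n. act R (fps_nth \<alpha> i) (fps_nth X (n - i)))"

text \<open>The extension of \<open>\<Sum> t\<^sup>i \<phi>\<^sub>i\<close> to power series.\<close>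

definition series_map :: "(nat \<Rightarrow> 'v \<Rightarrow> 'v) \<Rightarrow> 'v::ab_group_add fps \<Rightarrow> 'v fps" where
  "series_map \<phi> X = Abs_fps (\<lambda>n. \<Sum>i\<le>n. \<phi> i (fps_nth X (n - i)))"

text \<open>The extension of \<open>m\<^sub>t = \<Sum> t\<^sup>i m\<^sub>i\<close> to a map of two arguments on \<open>L[[t]]\<close>.\<close>

definition series_bracket :: "(nat \<Rightarrow> 'l list \<Rightarrow> 'l) \<Rightarrow> 'l::ab_group_add fps list \<Rightarrow> 'l fps" where
  "series_bracket m Xs =
    (if length Xs = 2
     then Abs_fps (\<lambda>n. \<Sum>i\<le>n. \<Sum>j\<le>n - i. m i [fps_nth (Xs ! 0) j, fps_nth (Xs ! 1) (n - i - j)])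
     else 0)"

definition is_deformation ::
  "('k::field, 'a::ring, 'l::ab_group_add) lr_data \<Rightarrow> (nat \<Rightarrow> 'l list \<Rightarrow> 'l) \<Rightarrow> bool" where
  "is_deformation R m \<longleftrightarrow>
    m 0 = lie_cochain R \<and> (\<forall>i\<ge>1. m i \<in> Der_LL R 1) \<and>
    cochain_bracket (scale_fps (scaleL R)) (gr_fps (grL R)) 2 2
      (series_bracket m) (series_bracket m) = (\<lambda>_. 0)"

text \<open>An even formal automorphism \<open>id + \<Sum> t\<^sup>i \<phi>\<^sub>i\<close> of \<open>L[[t]]\<close>, with \<open>\<phi>\<^sub>i\<close> even and
  linear over the ground field. Bijectivity is automatic, since \<open>\<phi>\<^sub>0 = id\<close>. As \<open>L[[t]]\<close> is a module
  over \<open>A[[t]]\<close>, an automorphism has to respect the module structure; in Lie-Rinehart theory this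
  means along some automorphism \<open>id + \<Sum> t\<^sup>i \<psi>\<^sub>i\<close> of the superalgebra \<open>A[[t]]\<close>, the
  \<open>A[[t]]\<close>-linear case being \<open>\<psi>\<^sub>i = 0\<close> for \<open>i \<ge> 1\<close>. Without this, \<open>\<phi>\<^sub>1\<close> need not belong to
  \<open>Der\<^sup>0(L,L)\<close>, and the coboundary of \<open>\<phi>\<^sub>1\<close> is in general not in \<open>B\<^sup>2\<close>.\<close>

definition formal_automorphism ::
  "('k::field, 'a::ring, 'l::ab_group_add) lr_data \<Rightarrow> (nat \<Rightarrow> 'l \<Rightarrow> 'l) \<Rightarrow> bool" where
  "formal_automorphism R \<phi> \<longleftrightarrow>
    \<phi> 0 = id \<and> (\<forall>i\<ge>1. even_linear (scaleL R) (grL R) (\<phi> i)) \<and>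
    (\<exists>\<psi>. \<psi> 0 = id \<and> (\<forall>i\<ge>1. even_linear (scaleA R) (grA R) (\<psi> i)) \<and>
      (\<forall>\<alpha> \<beta>. series_map \<psi> (\<alpha> * \<beta>) = series_map \<psi> \<alpha> * series_map \<psi> \<beta>) \<and>
      (\<forall>\<alpha> X. series_map \<phi> (act_fps R \<alpha> X) = act_fps R (series_map \<psi> \<alpha>) (series_map \<phi> X)))"

definition equivalent_deformations ::
  "('k::field, 'a::ring, 'l::ab_group_add) lr_data
    \<Rightarrow> (nat \<Rightarrow> 'l list \<Rightarrow> 'l) \<Rightarrow> (nat \<Rightarrow> 'l list \<Rightarrow> 'l) \<Rightarrow> bool" where
  "equivalent_deformations R m m' \<longleftrightarrow>
    (\<exists>\<phi>. formal_automorphism R \<phi> \<and>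
      (\<forall>X Y. series_map \<phi> (series_bracket m' [X, Y]) =
              series_bracket m [series_map \<phi> X, series_map \<phi> Y]))"

end

theory Submission
  imports Defs
begin

text \<open>Evaluate the two identities in \<open>L[[t]]\<close> on constant series and compare the coefficients of
  \<open>t\<close>. From \<open>[m\<^sub>t,m\<^sub>t] = 0\<close> one gets \<open>2[m,m\<^sub>1] = 0\<close>, so \<open>m\<^sub>1\<close> is a cocycle in characteristic zero.
  From \<open>\<Phi>\<^sub>t(m'\<^sub>t(x,y)) = m\<^sub>t(\<Phi>\<^sub>t(x),\<Phi>\<^sub>t(y))\<close> one gets
  \<open>m'\<^sub>1(x,y) - m\<^sub>1(x,y) = [\<phi>\<^sub>1(x),y] + [x,\<phi>\<^sub>1(y)] - \<phi>\<^sub>1[x,y]\<close>, which is \<open>\<delta>\<phi>\<^sub>1\<close>. Finally \<open>\<phi>\<^sub>1\<close> lies in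
  \<open>Der\<^sup>0(L,L)\<close>: the coefficients of \<open>t\<close> in the compatibilities with the algebra and module structures
  say that \<open>\<psi>\<^sub>1\<close> is a derivation of \<open>A\<close> and the symbol of \<open>\<phi>\<^sub>1\<close>.\<close>

section \<open>Linear and multilinear maps\<close>

lemma linear_diff_fun:
  assumes "Vector_Spaces.linear s s' f" "Vector_Spaces.linear s s' g"
  shows "Vector_Spaces.linear s s' (\<lambda>x. f x - g x)"
proof -
  interpret f: Vector_Spaces.linear s s' f by fact
  interpret g: Vector_Spaces.linear s s' g by fact
  show ?thesis
    by unfold_locales
      (simp_all add: f.add g.add f.scale g.scale f.vs2.scale_right_diff_distrib)
qed

lemma linear_zero_fun:
  assumes "vector_space s" "vector_space s'"
  shows "Vector_Spaces.linear s s' (\<lambda>_. 0)"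
proof -
  interpret v: vector_space s by fact
  interpret w: vector_space s' by fact
  show ?thesis by unfold_locales simp_all
qed

lemma linear_at_0: "Vector_Spaces.linear s s' f \<Longrightarrow> f 0 = 0"
  by (metis linear_iff_module_hom module_hom.zero)

lemma linear_at_add: "Vector_Spaces.linear s s' f \<Longrightarrow> f (x + y) = f x + f y"
  by (metis linear_iff_module_hom module_hom.add)

lemma linear_at_diff: "Vector_Spaces.linear s s' f \<Longrightarrow> f (x - y) = f x - f y"
  by (metis linear_iff_module_hom module_hom.diff)

lemma multilinear_map_diff:
  assumes "multilinear_map s s' n f" "multilinear_map s s' n g"
  shows "multilinear_map s s' n (\<lambda>xs. f xs - g xs)"
  using assms unfolding multilinear_map_def by (auto intro!: linear_diff_fun)

lemma multilinear_map_eq_0: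
  assumes "multilinear_map s s' n f" "length xs = n" "i < n" "xs ! i = 0"
  shows "f xs = 0"
proof -
  have "Vector_Spaces.linear s s' (\<lambda>x. f (xs[i := x]))"
    using assms unfolding multilinear_map_def by blast
  from linear_at_0[OF this] show ?thesis
    using assms by (metis list_update_id)
qed

section \<open>Super vector spaces\<close>

lemma bit_eq_0_or_1: "(d::bit) = 0 \<or> d = 1"
  by (cases d) auto

text \<open>Two candidates differ by an element of both degrees, hence by 0. The grading is only
  assumed closed under differences with trivial intersection, so that the lemma serves both
  \<open>gr\<close> and the coefficientwise grading \<open>gr_fps gr\<close>.\<close>

lemma component_unique:
  fixes gr :: "bit \<Rightarrow> 'v::ab_group_add set"
  assumes "\<And>e u v. u \<in> gr e \<Longrightarrow> v \<in> gr e \<Longrightarrow> u - v \<in> gr e"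
    and "gr 0 \<inter> gr 1 \<subseteq> {0}"
    and "y \<in> gr d" "x - y \<in> gr (d + 1)"
  shows "component gr d x = y"
  unfolding component_def
proof (rule the_equality)
  fix z assume z: "z \<in> gr d \<and> x - z \<in> gr (d + 1)"
  have "z - y \<in> gr d" using assms z by blast
  moreover have "(x - y) - (x - z) \<in> gr (d + 1)" using assms z by blast
  ultimately have "z - y \<in> gr 0 \<inter> gr 1"
    using bit_eq_0_or_1[of d] by (auto simp: algebra_simps)
  then show "z = y" using assms by auto
qed (use assms in auto)

context super_space
begin

lemma gr_diff: "u \<in> gr e \<Longrightarrow> v \<in> gr e \<Longrightarrow> u - v \<in> gr e"
  using subspace_gr subspace_diff by blast

lemma gr_zero: "0 \<in> gr e"
  using subspace_gr subspace_0 by blast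

lemma component_split:
  "component gr 0 x \<in> gr 0 \<and> component gr 1 x \<in> gr 1 \<and> component gr 0 x + component gr 1 x = x"
proof -
  obtain u w where uw: "u \<in> gr 0" "w \<in> gr 1" "x = u + w" using gr_sum by blast
  have "component gr 0 x = u" "component gr 1 x = w"
    by (rule component_unique; use uw gr_diff gr_Int in auto)+
  with uw show ?thesis by auto
qed

lemma component_in: "component gr d x \<in> gr d"
  using component_split bit_eq_0_or_1[of d] by auto

lemma component_in_compl: "x - component gr d x \<in> gr (d + 1)"
  using component_split[of x] bit_eq_0_or_1[of d]
  by (auto simp: algebra_simps simp del: add_bit_eq_xor) (metis add_diff_cancel_left' add_diff_cancel_right')+

text \<open>Links the decomposition inside \<open>circ\<close> on \<open>L[[t]]\<close> to the one
  on \<open>L\<close>: the series of coefficientwise components satisfies the property that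
  characterises a component for \<open>gr_fps gr\<close>.\<close>

lemma component_gr_fps: "component (gr_fps gr) d X = Abs_fps (\<lambda>n. component gr d (fps_nth X n))"
proof (rule component_unique)
  show "gr_fps gr 0 \<inter> gr_fps gr 1 \<subseteq> {0}"
    using gr_Int by (fastforce simp: gr_fps_def fps_eq_iff)
qed (auto simp: gr_fps_def gr_diff component_in component_in_compl simp del: add_bit_eq_xor)

end

section \<open>Superderivations and Der(A)\<close>

lemma superderivationsD:
  assumes "D \<in> superderivations s gr d"
  shows "Vector_Spaces.linear s s D"
    and "a \<in> gr e \<Longrightarrow> D a \<in> gr (d + e)"
    and "a \<in> gr e \<Longrightarrow> D (a * b) = D a * b + s (ksign (e * d)) (a * D b)"
proof -
  note D = assms[unfolded superderivations_def mem_Collect_eq]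
  show "Vector_Spaces.linear s s D" by (rule D[THEN conjunct1])
  show "D a \<in> gr (d + e)" if "a \<in> gr e"
    by (rule subsetD[OF D[THEN conjunct2, THEN conjunct1, rule_format] imageI[OF that]])
  show "D (a * b) = D a * b + s (ksign (e * d)) (a * D b)" if "a \<in> gr e"
    by (rule D[THEN conjunct2, THEN conjunct2, rule_format, OF that])
qed

lemma superderivationsI:
  assumes "Vector_Spaces.linear s s D"
    and "\<And>e a. a \<in> gr e \<Longrightarrow> D a \<in> gr (d + e)"
    and "\<And>e a b. a \<in> gr e \<Longrightarrow> D (a * b) = D a * b + s (ksign (e * d)) (a * D b)"
  shows "D \<in> superderivations s gr d"
  unfolding superderivations_def mem_Collect_eq
  by (intro conjI allI ballI image_subsetI assms)

lemma superderivations_diff: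
  assumes "super_space s gr" "D \<in> superderivations s gr d" "E \<in> superderivations s gr d"
  shows "(\<lambda>a. D a - E a) \<in> superderivations s gr d"
proof -
  interpret super_space s gr by fact
  note D = superderivationsD[OF assms(2)] and E = superderivationsD[OF assms(3)]
  show ?thesis
  proof (rule superderivationsI)
    show "Vector_Spaces.linear s s (\<lambda>a. D a - E a)"
      by (rule linear_diff_fun[OF D(1) E(1)])
  next
    fix e a assume a: "a \<in> gr e"
    show "D a - E a \<in> gr (d + e)"
      by (rule gr_diff[OF D(2)[OF a] E(2)[OF a]])
    show "D (a * b) - E (a * b) = (D a - E a) * b + s (ksign (e * d)) (a * (D b - E b))" for b
      unfolding D(3)[OF a] E(3)[OF a] left_diff_distrib right_diff_distrib
        scale_right_diff_distrib add_diff_add ..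
  qed
qed

lemma DerI:
  assumes "D \<in> superderivations s gr 0" "E \<in> superderivations s gr 1"
  shows "(\<lambda>a. D a + E a) \<in> Der s gr"
  unfolding Der_def mem_Collect_eq
  by (rule exI[of _ D], rule exI[of _ E]) (use assms in simp)

lemma DerE:
  assumes "D \<in> Der s gr"
  obtains D0 D1 where "D = (\<lambda>a. D0 a + D1 a)"
    "D0 \<in> superderivations s gr 0" "D1 \<in> superderivations s gr 1"
  using assms unfolding Der_def mem_Collect_eq by (elim exE conjE) (rule that)

text \<open>The sign in the Leibniz rule depends on the degree, so differences are formed separately
  on the even and the odd summands.\<close>

lemma Der_diff:
  assumes "super_space s gr" "D \<in> Der s gr" "E \<in> Der s gr"
  shows "(\<lambda>a. D a - E a) \<in> Der s gr"
proof -
  obtain D0 D1 where D: "D = (\<lambda>a. D0 a + D1 a)"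
      "D0 \<in> superderivations s gr 0" "D1 \<in> superderivations s gr 1"
    using assms(2) by (rule DerE)
  obtain E0 E1 where E: "E = (\<lambda>a. E0 a + E1 a)"
      "E0 \<in> superderivations s gr 0" "E1 \<in> superderivations s gr 1"
    using assms(3) by (rule DerE)
  have "(\<lambda>a. D a - E a) = (\<lambda>a. (D0 a - E0 a) + (D1 a - E1 a))"
    by (simp only: D(1) E(1) add_diff_add)
  then show ?thesis
    using DerI[OF superderivations_diff[OF assms(1) D(2) E(2)]
        superderivations_diff[OF assms(1) D(3) E(3)]]
    by (simp only:)
qed

section \<open>The deformation complex\<close>

text \<open>Both blocks have one element, so monotonicity is void and every permutation counts.
  These are the terms of \<open>m \<circ> D\<close> for a unary \<open>D\<close>.\<close>

lemma shuffles_of_1_2: "shuffles_of 1 2 = {id, Transposition.transpose 0 1}"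
proof -
  have *: "{..<2} = {0, 1::nat}" "{1..<2} = {1::nat}" by auto
  show ?thesis
    unfolding shuffles_of_def * permutes_doubleton_iff
    by (auto simp: strict_mono_on_def)
qed

text \<open>The first block is everything, so the permutation must be increasing. This is the only
  term of \<open>D \<circ> m\<close> for a unary \<open>D\<close>.\<close>

lemma shuffles_of_2_2: "shuffles_of 2 2 = {id}"
proof -
  have *: "{..<2} = {0, 1::nat}" by auto
  have "\<not> strict_mono_on {0, 1} (Transposition.transpose 0 (1::nat))"
    using strict_mono_onD[of "{0, 1}" "Transposition.transpose 0 (1::nat)" 0 1] by auto
  then show ?thesis
    unfolding shuffles_of_def * permutes_doubleton_iff
    by (auto simp: strict_mono_on_def)
qed

lemma koszul_sign_id: "koszul_sign id ds = 1"
  unfolding koszul_sign_def by (rule prod.neutral) auto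

lemma koszul_sign_transpose:
  "koszul_sign (Transposition.transpose 0 1) [d, e] = (ksign (d * e) :: 'k::comm_ring_1)"
proof -
  \<comment> \<open>The transposition has the single inversion (0,1), so the product has one
    factor.\<close>
  have "{(i, j). i < j \<and> j < length [d, e] \<and>
      Transposition.transpose 0 1 j < Transposition.transpose 0 (1::nat) i} = {(0, 1)}"
    by (auto simp: Transposition.transpose_def less_Suc_eq)
  then show ?thesis
    unfolding koszul_sign_def by (simp add: mult.commute[of e d] del: mult_bit_eq_and)
qed

lemma bit_lists_2: "{ds :: bit list. length ds = 2} = {[0,0], [0,1], [1,0], [1,1]}"
proof (rule set_eqI)
  fix ds :: "bit list"
  have "\<exists>d e. ds = [d, e]" if "length ds = 2"
    using that by (auto simp: length_Suc_conv numeral_2_eq_2)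
  moreover have "[d, e] \<in> {[0,0], [0,1], [1,0], [1,1]}" for d e :: bit
    by (cases d; cases e) auto
  ultimately show "ds \<in> {ds. length ds = 2} \<longleftrightarrow> ds \<in> {[0,0], [0,1], [1,0], [1,1]}"
    by auto
qed

text \<open>In the coefficient of t^n only \<open>\<phi> n\<close> meets the nonzero constant
  coefficient; the other summands are values at 0.\<close>

lemma series_map_const:
  assumes "\<And>i. \<phi> i 0 = 0"
  shows "series_map \<phi> (fps_const x) = Abs_fps (\<lambda>n. \<phi> n x)"
proof (rule fps_ext)
  fix n
  have "(\<Sum>i\<le>n. \<phi> i (fps_nth (fps_const x) (n - i))) = (\<Sum>i\<le>n. if i = n then \<phi> n x else 0)"
    by (rule sum.cong) (auto simp: assms)
  then show "fps_nth (series_map \<phi> (fps_const x)) n = fps_nth (Abs_fps (\<lambda>n. \<phi> n x)) n"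
    by (simp add: series_map_def)
qed

context lie_rinehart_superalgebra
begin

sublocale A: super_space "scaleA R" "grA R" by (rule super_A)
sublocale L: super_space "scaleL R" "grL R" by (rule super_L)

lemmas lie_add_left = linear_at_add[OF lie_linear_left]
  and lie_add_right = linear_at_add[OF lie_linear_right]
  and lie_diff_left = linear_at_diff[OF lie_linear_left]
  and lie_0_left = linear_at_0[OF lie_linear_left]
  and lie_0_right = linear_at_0[OF lie_linear_right]
  and act_diff_left = linear_at_diff[OF act_linear_left]
  and act_diff_right = linear_at_diff[OF act_linear_right]
  and act_0_left = linear_at_0[OF act_linear_left]
  and act_0_right = linear_at_0[OF act_linear_right]

section \<open>The spaces Der^n(L,L) are closed under differences\<close>

lemma zero_superderivation: "(\<lambda>_. 0) \<in> superderivations (scaleA R) (grA R) d"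
  unfolding superderivations_def
  by (auto intro: linear_zero_fun A.vector_space_axioms A.gr_zero)

lemma Der_LL_hom_zero: "(\<lambda>_. 0) \<in> Der_LL_hom R n j"
proof -
  have z: "(\<lambda>_. 0) \<in> Der (scaleA R) (grA R)"
    using DerI[OF zero_superderivation zero_superderivation] by simp
  show ?thesis
    unfolding Der_LL_hom_def multilinear_map_def
    by (auto intro!: linear_zero_fun A.vector_space_axioms L.vector_space_axioms L.gr_zero z
        exI[of _ "\<lambda>_ _. 0"] simp: act_0_left act_0_right)
qed

text \<open>Condition (2) with the existential witness made explicit, so that symbols of two
  cochains can be subtracted.\<close>

definition symbol_map :: "nat \<Rightarrow> bit \<Rightarrow> ('l list \<Rightarrow> 'l) \<Rightarrow> ('l list \<Rightarrow> 'a \<Rightarrow> 'a) \<Rightarrow> bool" where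
  "symbol_map n j f \<sigma> \<longleftrightarrow>
    (\<forall>xs. length xs = n \<longrightarrow> \<sigma> xs \<in> Der (scaleA R) (grA R)) \<and>
    (\<forall>a. multilinear_map (scaleL R) (scaleA R) n (\<lambda>xs. \<sigma> xs a)) \<and>
    (\<forall>ds xs y e a. length xs = n \<and> homogeneous_list (grL R) ds xs \<and> a \<in> grA R e
      \<longrightarrow> f (xs @ [act R a y]) =
            scaleL R (ksign (e * (j + sum_list ds))) (act R a (f (xs @ [y])))
            + act R (\<sigma> xs a) y)"

lemma Der_LL_hom_iff:
  "f \<in> Der_LL_hom R n j \<longleftrightarrow>
    (\<forall>xs. length xs \<noteq> n + 1 \<longrightarrow> f xs = 0) \<and>
    multilinear_map (scaleL R) (scaleL R) (n + 1) f \<and>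
    (\<forall>ds xs. length xs = n + 1 \<and> homogeneous_list (grL R) ds xs
       \<longrightarrow> f xs \<in> grL R (j + sum_list ds)) \<and>
    (\<forall>ds xs i. length xs = n + 1 \<and> homogeneous_list (grL R) ds xs \<and> i < n
       \<longrightarrow> f xs = - scaleL R (ksign (ds ! i * ds ! (i + 1)))
                     (f (xs[i := xs ! (i + 1), i + 1 := xs ! i]))) \<and>
    (\<exists>\<sigma>. symbol_map n j f \<sigma>)"
  unfolding Der_LL_hom_def symbol_map_def by (rule mem_Collect_eq)

lemma Der_LL_homD:
  assumes "f \<in> Der_LL_hom R n j"
  shows "length xs \<noteq> n + 1 \<Longrightarrow> f xs = 0"
    and "multilinear_map (scaleL R) (scaleL R) (n + 1) f"
    and "length xs = n + 1 \<and> homogeneous_list (grL R) ds xs \<Longrightarrow> f xs \<in> grL R (j + sum_list ds)"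
    and "length xs = n + 1 \<and> homogeneous_list (grL R) ds xs \<and> i < n \<Longrightarrow>
      f xs = - scaleL R (ksign (ds ! i * ds ! (i + 1))) (f (xs[i := xs ! (i + 1), i + 1 := xs ! i]))"
    and "\<exists>\<sigma>. symbol_map n j f \<sigma>"
proof -
  note f = assms[unfolded Der_LL_hom_iff]
  show "f xs = 0" if "length xs \<noteq> n + 1"
    by (rule f[THEN conjunct1, rule_format, OF that])
  note f = f[THEN conjunct2]
  show "multilinear_map (scaleL R) (scaleL R) (n + 1) f"
    by (rule f[THEN conjunct1])
  note f = f[THEN conjunct2]
  show "f xs \<in> grL R (j + sum_list ds)"
    if "length xs = n + 1 \<and> homogeneous_list (grL R) ds xs"
    by (rule f[THEN conjunct1, THEN spec, THEN spec, THEN mp, OF that])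
  note f = f[THEN conjunct2]
  show "f xs = - scaleL R (ksign (ds ! i * ds ! (i + 1))) (f (xs[i := xs ! (i + 1), i + 1 := xs ! i]))"
    if "length xs = n + 1 \<and> homogeneous_list (grL R) ds xs \<and> i < n"
    by (rule f[THEN conjunct1, THEN spec, THEN spec, THEN spec, THEN mp, OF that])
  show "\<exists>\<sigma>. symbol_map n j f \<sigma>"
    by (rule f[THEN conjunct2])
qed

text \<open>For a fixed degree \<open>j\<close> the sign in condition (2) is the same for
  \<open>f\<close> and \<open>g\<close>, so the condition is linear in the pair of a cochain and its
  symbol.\<close>

lemma symbol_map_diff:
  assumes "symbol_map n j f \<sigma>" "symbol_map n j g \<tau>"
  shows "symbol_map n j (\<lambda>xs. f xs - g xs) (\<lambda>xs a. \<sigma> xs a - \<tau> xs a)"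
  unfolding symbol_map_def
proof (intro conjI allI impI)
  show "(\<lambda>a. \<sigma> xs a - \<tau> xs a) \<in> Der (scaleA R) (grA R)" if "length xs = n" for xs
    by (rule Der_diff[OF super_A]) (use assms that in \<open>simp_all only: symbol_map_def\<close>)
  show "multilinear_map (scaleL R) (scaleA R) n (\<lambda>xs. \<sigma> xs a - \<tau> xs a)" for a
    by (rule multilinear_map_diff) (use assms in \<open>simp_all only: symbol_map_def\<close>)
  fix ds xs y e a
  assume h: "length xs = n \<and> homogeneous_list (grL R) ds xs \<and> a \<in> grA R e"
  let ?k = "ksign (e * (j + sum_list ds))"
  have "f (xs @ [act R a y]) = scaleL R ?k (act R a (f (xs @ [y]))) + act R (\<sigma> xs a) y"
    using assms(1) h unfolding symbol_map_def by blast
  moreover have "g (xs @ [act R a y]) = scaleL R ?k (act R a (g (xs @ [y]))) + act R (\<tau> xs a) y"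
    using assms(2) h unfolding symbol_map_def by blast
  ultimately show "f (xs @ [act R a y]) - g (xs @ [act R a y]) =
      scaleL R ?k (act R a (f (xs @ [y]) - g (xs @ [y]))) + act R (\<sigma> xs a - \<tau> xs a) y"
    by (simp only: act_diff_left act_diff_right L.scale_right_diff_distrib add_diff_add)
qed

lemma Der_LL_hom_diff:
  assumes "f \<in> Der_LL_hom R n j" "g \<in> Der_LL_hom R n j"
  shows "(\<lambda>xs. f xs - g xs) \<in> Der_LL_hom R n j"
proof -
  note f = Der_LL_homD[OF assms(1)] and g = Der_LL_homD[OF assms(2)]
  obtain \<sigma> where \<sigma>: "symbol_map n j f \<sigma>" using f(5) by (rule exE)
  obtain \<tau> where \<tau>: "symbol_map n j g \<tau>" using g(5) by (rule exE)
  show ?thesis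
    unfolding Der_LL_hom_iff
  proof (intro conjI allI impI)
    show "multilinear_map (scaleL R) (scaleL R) (n + 1) (\<lambda>xs. f xs - g xs)"
      by (rule multilinear_map_diff[OF f(2) g(2)])
    show "\<exists>\<sigma>. symbol_map n j (\<lambda>xs. f xs - g xs) \<sigma>"
      by (rule exI, rule symbol_map_diff[OF \<sigma> \<tau>])
    show "f xs - g xs = 0" if "length xs \<noteq> n + 1" for xs
      using f(1)[OF that] g(1)[OF that] by simp
    show "f xs - g xs \<in> grL R (j + sum_list ds)"
      if "length xs = n + 1 \<and> homogeneous_list (grL R) ds xs" for xs ds
      by (rule L.gr_diff[OF f(3)[OF that] g(3)[OF that]])
    show "f xs - g xs = - scaleL R (ksign (ds ! i * ds ! (i + 1)))
        (f (xs[i := xs ! (i + 1), i + 1 := xs ! i]) - g (xs[i := xs ! (i + 1), i + 1 := xs ! i]))"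
      if "length xs = n + 1 \<and> homogeneous_list (grL R) ds xs \<and> i < n" for xs ds i
      unfolding L.scale_right_diff_distrib minus_diff_eq
      by (subst f(4)[OF that], subst g(4)[OF that]) (rule minus_diff_minus[THEN trans], simp)
  qed
qed

lemma Der_LLI:
  assumes "f \<in> Der_LL_hom R n 0" "g \<in> Der_LL_hom R n 1"
  shows "(\<lambda>xs. f xs + g xs) \<in> Der_LL R n"
  unfolding Der_LL_def mem_Collect_eq
  by (rule exI[of _ f], rule exI[of _ g]) (use assms in simp)

lemma Der_LLE:
  assumes "f \<in> Der_LL R n"
  obtains f0 f1 where "f = (\<lambda>xs. f0 xs + f1 xs)"
    "f0 \<in> Der_LL_hom R n 0" "f1 \<in> Der_LL_hom R n 1"
  using assms unfolding Der_LL_def mem_Collect_eq by (elim exE conjE) (rule that)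

lemma Der_LL_zero: "(\<lambda>_. 0) \<in> Der_LL R n"
  using Der_LLI[OF Der_LL_hom_zero Der_LL_hom_zero] by simp

lemma Der_LL_diff:
  assumes "f \<in> Der_LL R n" "g \<in> Der_LL R n"
  shows "(\<lambda>xs. f xs - g xs) \<in> Der_LL R n"
proof -
  obtain f0 f1 where f: "f = (\<lambda>xs. f0 xs + f1 xs)"
      "f0 \<in> Der_LL_hom R n 0" "f1 \<in> Der_LL_hom R n 1"
    using assms(1) by (rule Der_LLE)
  obtain g0 g1 where g: "g = (\<lambda>xs. g0 xs + g1 xs)"
      "g0 \<in> Der_LL_hom R n 0" "g1 \<in> Der_LL_hom R n 1"
    using assms(2) by (rule Der_LLE)
  have "(\<lambda>xs. f xs - g xs) = (\<lambda>xs. (f0 xs - g0 xs) + (f1 xs - g1 xs))"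
    by (simp only: f(1) g(1) add_diff_add)
  then show ?thesis
    using Der_LLI[OF Der_LL_hom_diff[OF f(2) g(2)] Der_LL_hom_diff[OF f(3) g(3)]]
    by (simp only:)
qed

text \<open>The first fact is the normalisation of cochains, the second is multilinearity. The
  second makes sums over coefficients collapse when arguments are constant series.\<close>

lemma Der_LL_eq_0:
  assumes "f \<in> Der_LL R n"
  shows "length xs \<noteq> n + 1 \<Longrightarrow> f xs = 0"
    and "length xs = n + 1 \<Longrightarrow> i < n + 1 \<Longrightarrow> xs ! i = 0 \<Longrightarrow> f xs = 0"
proof -
  obtain f0 f1 where f: "f = (\<lambda>xs. f0 xs + f1 xs)"
      "f0 \<in> Der_LL_hom R n 0" "f1 \<in> Der_LL_hom R n 1"
    using assms(1) by (rule Der_LLE)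
  show "f xs = 0" if "length xs \<noteq> n + 1"
    using Der_LL_homD(1)[OF f(2) that] Der_LL_homD(1)[OF f(3) that] by (simp add: f(1))
  show "f xs = 0" if "length xs = n + 1" "i < n + 1" "xs ! i = 0"
    using multilinear_map_eq_0[OF Der_LL_homD(2)[OF f(2)] that]
      multilinear_map_eq_0[OF Der_LL_homD(2)[OF f(3)] that] by (simp add: f(1))
qed

section \<open>Coboundaries and cohomology classes\<close>

lemma def_cochains_zero: "(\<lambda>_. 0) \<in> def_cochains R n"
  by (auto simp: def_cochains_def Der_LL_zero split: nat.split)

lemma def_cochains_diff:
  "f \<in> def_cochains R n \<Longrightarrow> g \<in> def_cochains R n \<Longrightarrow> (\<lambda>xs. f xs - g xs) \<in> def_cochains R n"
  by (auto simp: def_cochains_def Der_LL_diff split: nat.splits)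

text \<open>Both terms are additive in the cochain: \<open>m \<circ> D\<close> puts the value of
  \<open>D\<close> into the first slot of the biadditive bracket, and \<open>D \<circ> m\<close>
  evaluates \<open>D\<close> at lists that do not depend on \<open>D\<close>.\<close>

lemma def_differential_diff:
  "def_differential R n (\<lambda>xs. f xs - g xs) =
    (\<lambda>xs. def_differential R n f xs - def_differential R n g xs)"
proof -
  have 1: "circ (scaleL R) (grL R) 2 n (lie_cochain R) (\<lambda>xs. f xs - g xs) xs =
    circ (scaleL R) (grL R) 2 n (lie_cochain R) f xs -
    circ (scaleL R) (grL R) 2 n (lie_cochain R) g xs" for xs
    by (simp add: circ_def Let_def lie_cochain_def lie_diff_left L.scale_right_diff_distrib
        sum_subtractf)
  have 2: "circ (scaleL R) (grL R) n 2 (\<lambda>xs. f xs - g xs) (lie_cochain R) xs =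
    circ (scaleL R) (grL R) n 2 f (lie_cochain R) xs -
    circ (scaleL R) (grL R) n 2 g (lie_cochain R) xs" for xs
    by (simp add: circ_def Let_def L.scale_right_diff_distrib sum_subtractf)
  show ?thesis
    by (simp add: fun_eq_iff def_differential_def cochain_bracket_def 1 2
        L.scale_right_diff_distrib)
qed

lemma def_coboundaries_zero: "(\<lambda>_. 0) \<in> def_coboundaries R n"
proof (cases n)
  case (Suc k)
  \<comment> \<open>Additivity applied to 0 = 0 - 0.\<close>
  have "def_differential R k (\<lambda>xs. 0) = (\<lambda>_. 0)"
    using def_differential_diff[of k "\<lambda>_. 0" "\<lambda>_. 0"] by simp
  then show ?thesis
    using imageI[OF def_cochains_zero[of k], of "def_differential R k"]
    by (simp add: Suc def_coboundaries_def)
qed (simp add: def_coboundaries_def)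

lemma def_coboundaries_diff:
  assumes "f \<in> def_coboundaries R n" "g \<in> def_coboundaries R n"
  shows "(\<lambda>xs. f xs - g xs) \<in> def_coboundaries R n"
proof (cases n)
  case 0
  with assms show ?thesis by (simp add: def_coboundaries_def)
next
  case (Suc k)
  obtain D E where D: "D \<in> def_cochains R k" "f = def_differential R k D"
    and E: "E \<in> def_cochains R k" "g = def_differential R k E"
    using assms by (auto simp: Suc def_coboundaries_def)
  have "(\<lambda>xs. f xs - g xs) = def_differential R k (\<lambda>xs. D xs - E xs)"
    unfolding D(2) E(2) def_differential_diff ..
  then show ?thesis
    using imageI[OF def_cochains_diff[OF D(1) E(1)], of "def_differential R k"]
    by (simp add: Suc def_coboundaries_def)
qed

text \<open>Turns equality of classes into membership of a pair in the relation. Coboundaries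
  contain 0 and are closed under differences, which yields all three properties.\<close>

lemma equiv_cohomologous: "equiv (def_cocycles R n) (cohomologous R n)"
proof (rule equivI)
  show "cohomologous R n \<subseteq> def_cocycles R n \<times> def_cocycles R n"
    by (auto simp: cohomologous_def)
  show "refl_on (def_cocycles R n) (cohomologous R n)"
    by (auto simp: refl_on_def cohomologous_def def_coboundaries_zero)
  have neg: "(\<lambda>xs. g xs - f xs) \<in> def_coboundaries R n"
    if "(\<lambda>xs. f xs - g xs) \<in> def_coboundaries R n" for f g
    using def_coboundaries_diff[OF def_coboundaries_zero that] by simp
  then show "sym (cohomologous R n)"
    by (auto simp: sym_def cohomologous_def)
  show "trans (cohomologous R n)"
  proof (rule transI)
    fix f g h assume fg: "(f, g) \<in> cohomologous R n" and gh: "(g, h) \<in> cohomologous R n"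
    have "(\<lambda>xs. f xs - g xs) \<in> def_coboundaries R n" "(\<lambda>xs. g xs - h xs) \<in> def_coboundaries R n"
      using fg gh by (simp_all add: cohomologous_def)
    \<comment> \<open>Uses f - h = (f - g) - (h - g).\<close>
    from def_coboundaries_diff[OF this(1) neg[OF this(2)]]
    have "(\<lambda>xs. f xs - h xs) \<in> def_coboundaries R n" by simp
    with fg gh show "(f, h) \<in> cohomologous R n"
      by (simp add: cohomologous_def)
  qed
qed

section \<open>The coboundary of an even linear map\<close>

text \<open>In \<open>m \<circ> D\<close> the identity shuffle gives the first term and the
  transposition the second; \<open>D \<circ> m\<close> gives the third. Its prefactor is (-1)^6 = 1,
  as one of the two cochains is unary.\<close>

lemma def_differential_unary:
  assumes lin: "Vector_Spaces.linear (scaleL R) (scaleL R) \<phi>"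
    and even: "\<And>d x. x \<in> grL R d \<Longrightarrow> \<phi> x \<in> grL R d"
    and D: "\<And>x. D [x] = \<phi> x"
  shows "def_differential R 1 D [x, y] = lie R (\<phi> x) y + lie R x (\<phi> y) - \<phi> (lie R x y)"
proof -
  let ?c = "component (grL R)"
  note add = linear_at_add[OF lin]
  let ?F = "\<lambda>x y. lie R (\<phi> x) y + lie R x (\<phi> y)"
  have tr: "sign (Transposition.transpose 0 (1::nat)) = - 1" by (simp add: sign_swap_id)
  have ne: "id \<noteq> Transposition.transpose 0 (1::nat)"
    by (metis id_apply transpose_apply_first zero_neq_one)
  have pair: "(\<Sum>\<tau>\<in>shuffles_of 1 2.
      let ys = map2 ?c [d, e] [x, y] in
        scaleL R (of_int (sign \<tau>) * koszul_sign \<tau> [d, e])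
          (lie_cochain R (D (map (\<lambda>i. ys ! \<tau> i) [0..<1]) # map (\<lambda>i. ys ! \<tau> i) [1..<2])))
     = ?F (?c d x) (?c e y)" for d e
  proof -
    have up: "[Suc 0..<2] = [1]" by (simp add: upt_rec)
    \<comment> \<open>Since \<open>\<phi>\<close> is even, the sign in skew-symmetry is exactly the
      Koszul sign of the transposition.\<close>
    have "lie R (?c d x) (\<phi> (?c e y)) =
        - scaleL R (ksign (d * e)) (lie R (\<phi> (?c e y)) (?c d x))"
      by (intro lie_skew even L.component_in)
    then show ?thesis
      using ne tr
      by (simp add: shuffles_of_1_2[unfolded One_nat_def] koszul_sign_id koszul_sign_transpose[unfolded One_nat_def] up D
          lie_cochain_def Let_def sign_id del: mult_bit_eq_and)
  qed
  have split: "\<And>z. ?c 0 z + ?c 1 z = z" using L.component_split by blast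
  have "circ (scaleL R) (grL R) 2 1 (lie_cochain R) D [x, y] =
      (\<Sum>ds\<in>{[0,0], [0,1], [1,0], [1,1]}. ?F (?c (ds ! 0) x) (?c (ds ! 1) y))"
    unfolding circ_def Let_def bit_lists_2[symmetric]
    using pair unfolding Let_def
    by (auto intro!: sum.cong simp: length_Suc_conv numeral_2_eq_2)
  \<comment> \<open>The four choices of degrees recombine by biadditivity, which removes the
    homogeneity of the arguments.\<close>
  also have "\<dots> = ?F (?c 0 x + ?c 1 x) (?c 0 y + ?c 1 y)"
    by (simp add: add lie_add_left lie_add_right algebra_simps)
  finally have 1: "circ (scaleL R) (grL R) 2 1 (lie_cochain R) D [x, y] = ?F x y"
    by (simp only: split)
  have "circ (scaleL R) (grL R) 1 2 D (lie_cochain R) [x, y] =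
      (\<Sum>ds\<in>{[0,0], [0,1], [1,0], [1,1]}. \<phi> (lie R (?c (ds ! 0) x) (?c (ds ! 1) y)))"
    unfolding circ_def Let_def bit_lists_2[symmetric]
    by (auto intro!: sum.cong simp: shuffles_of_2_2[unfolded numeral_2_eq_2] koszul_sign_id sign_id D lie_cochain_def
        length_Suc_conv numeral_2_eq_2)
  also have "\<dots> = \<phi> (lie R (?c 0 x + ?c 1 x) (?c 0 y + ?c 1 y))"
    by (simp add: add lie_add_left lie_add_right algebra_simps)
  finally have 2: "circ (scaleL R) (grL R) 1 2 D (lie_cochain R) [x, y] = \<phi> (lie R x y)"
    by (simp only: split)
  show ?thesis
    unfolding def_differential_def cochain_bracket_def 1 2 by simp
qed

section \<open>Deformations to first order\<close>

lemma deformation_eq_0: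
  assumes "is_deformation R m"
  shows "m i [0, y] = 0" "m i [x, 0] = 0"
proof -
  \<comment> \<open>The definition places \<open>m i\<close> in Der^1(L,L) for positive
    \<open>i\<close>; \<open>m 0\<close> is the bracket itself, whose bilinearity is an
    axiom.\<close>
  have *: "i = 0 \<and> m i = lie_cochain R \<or> m i \<in> Der_LL R 1"
    using assms unfolding is_deformation_def by (cases i) auto
  show "m i [0, y] = 0"
    using * Der_LL_eq_0(2)[of "m i" 1 "[0, y]" 0] by (auto simp: lie_cochain_def lie_0_left)
  show "m i [x, 0] = 0"
    using * Der_LL_eq_0(2)[of "m i" 1 "[x, 0]" 1] by (auto simp: lie_cochain_def lie_0_right)
qed

text \<open>The first argument stays a general series because in m_t(m_t(x,y),z) the inner value is
  one even when x, y, z are constants.\<close>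

lemma series_bracket_const_right:
  assumes "is_deformation R m"
  shows "fps_nth (series_bracket m [X, fps_const y]) n = (\<Sum>i\<le>n. m i [fps_nth X (n - i), y])"
proof -
  have "(\<Sum>j\<le>k. m i [fps_nth X j, fps_nth (fps_const y) (k - j)]) = m i [fps_nth X k, y]" for i k
  proof -
    have "(\<Sum>j\<le>k. m i [fps_nth X j, fps_nth (fps_const y) (k - j)]) =
        (\<Sum>j\<le>k. if j = k then m i [fps_nth X k, y] else 0)"
      by (rule sum.cong) (auto simp: deformation_eq_0[OF assms])
    then show ?thesis by simp
  qed
  then show ?thesis by (simp add: series_bracket_def del: fps_nth_fps_const diff_diff_left)
qed

lemma series_bracket_const:
  assumes "is_deformation R m"
  shows "series_bracket m [fps_const x, fps_const y] = Abs_fps (\<lambda>n. m n [x, y])"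
proof (rule fps_ext)
  fix n
  have "(\<Sum>i\<le>n. m i [if n - i = 0 then x else 0, y]) = (\<Sum>i\<le>n. if i = n then m n [x, y] else 0)"
    by (rule sum.cong) (auto simp: deformation_eq_0[OF assms])
  then show "fps_nth (series_bracket m [fps_const x, fps_const y]) n =
      fps_nth (Abs_fps (\<lambda>n. m n [x, y])) n"
    by (simp add: series_bracket_const_right[OF assms])
qed

lemma component_fps_const:
  "component (gr_fps (grL R)) d (fps_const x) = fps_const (component (grL R) d x)"
proof -
  have "component (grL R) d 0 = 0"
    by (rule component_unique) (use L.gr_diff L.gr_Int L.gr_zero in auto)
  then show ?thesis
    unfolding L.component_gr_fps by (simp add: fps_eq_iff)
qed

text \<open>Components of constants are constants, so both sides run over the same degrees, shuffles
  and signs; what remains is a Cauchy product and an exchange of finite sums.\<close>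

lemma circ_series_bracket_const:
  assumes "is_deformation R m" "length xs = 3"
  shows "fps_nth (circ (scale_fps (scaleL R)) (gr_fps (grL R)) 2 2
      (series_bracket m) (series_bracket m) (map fps_const xs)) n =
    (\<Sum>i\<le>n. circ (scaleL R) (grL R) 2 2 (m i) (m (n - i)) xs)"
proof -
  let ?ys = "\<lambda>ds. map2 (component (grL R)) ds xs"
  let ?c = "\<lambda>\<tau> ds. of_int (sign \<tau>) * koszul_sign \<tau> ds :: 'k"
  let ?D = "{ds :: bit list. length ds = 3}"
  let ?M = "series_bracket m"
  have ys: "map2 (component (gr_fps (grL R))) ds (map fps_const xs) = map fps_const (?ys ds)" for ds
    by (simp add: zip_map2 component_fps_const split_def)
  have up: "[0..<2] = [0, 1]" "[2..<3] = [2]" by (simp_all add: upt_rec)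
  have nth: "fps_nth (?M [?M [fps_const a, fps_const b], fps_const c]) n =
      (\<Sum>i\<le>n. m i [m (n - i) [a, b], c])" for a b c
    by (simp add: series_bracket_const[OF assms(1)] series_bracket_const_right[OF assms(1)])
  \<comment> \<open>The bound on the indices lets \<open>nth\<close> commute with
    \<open>map fps_const\<close>.\<close>
  have small: "\<tau> i < 3" if "\<tau> \<in> shuffles_of 2 3" "i < 3" for \<tau> i
    using that permutes_in_image[of \<tau> "{..<3}" i] by (auto simp: shuffles_of_def)
  have "circ (scale_fps (scaleL R)) (gr_fps (grL R)) 2 2 ?M ?M (map fps_const xs) =
      (\<Sum>ds\<in>?D. \<Sum>\<tau>\<in>shuffles_of 2 3. scale_fps (scaleL R) (?c \<tau> ds)
        (?M [?M [fps_const (?ys ds ! \<tau> 0), fps_const (?ys ds ! \<tau> 1)], fps_const (?ys ds ! \<tau> 2)]))"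
    unfolding circ_def Let_def ys
    using assms(2) by (auto intro!: sum.cong simp: up small simp del: upt_rec_numeral)
  then have "fps_nth (circ (scale_fps (scaleL R)) (gr_fps (grL R)) 2 2 ?M ?M (map fps_const xs)) n =
      (\<Sum>ds\<in>?D. \<Sum>\<tau>\<in>shuffles_of 2 3. \<Sum>i\<le>n. scaleL R (?c \<tau> ds)
        (m i [m (n - i) [?ys ds ! \<tau> 0, ?ys ds ! \<tau> 1], ?ys ds ! \<tau> 2]))"
    by (simp only: fps_sum_nth scale_fps_def fps_nth_Abs_fps nth L.scale_sum_right)
  also have "\<dots> = (\<Sum>i\<le>n. \<Sum>ds\<in>?D. \<Sum>\<tau>\<in>shuffles_of 2 3. scaleL R (?c \<tau> ds)
        (m i [m (n - i) [?ys ds ! \<tau> 0, ?ys ds ! \<tau> 1], ?ys ds ! \<tau> 2]))"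
    unfolding sum.swap[of _ "{..n}"] ..
  also have "\<dots> = (\<Sum>i\<le>n. circ (scaleL R) (grL R) 2 2 (m i) (m (n - i)) xs)"
    unfolding circ_def Let_def
    using assms(2) by (auto intro!: sum.cong simp: up simp del: upt_rec_numeral)
  finally show ?thesis .
qed

section \<open>The infinitesimal is a cocycle\<close>

lemma infinitesimal_cocycle:
  assumes "is_deformation R m" "(2::'k) \<noteq> 0"
  shows "m 1 \<in> def_cocycles R 2"
proof -
  have m1: "m 1 \<in> def_cochains R 2" and m0: "m 0 = lie_cochain R"
    using assms(1) by (simp_all add: is_deformation_def def_cochains_def numeral_2_eq_2)
  let ?circ = "circ (scaleL R) (grL R) 2 2"
  have "def_differential R 2 (m 1) xs = 0" for xs
  proof (cases "length xs = 3")
    case False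
    then show ?thesis
      by (simp add: def_differential_def cochain_bracket_def circ_def)
  next
    case True
    let ?P = "?circ (m 0) (m 1) xs + ?circ (m 1) (m 0) xs"
    let ?C = "circ (scale_fps (scaleL R)) (gr_fps (grL R)) 2 2 (series_bracket m) (series_bracket m)
      (map fps_const xs)"
    have "cochain_bracket (scale_fps (scaleL R)) (gr_fps (grL R)) 2 2
        (series_bracket m) (series_bracket m) (map fps_const xs) = 0"
      using assms(1) by (simp add: is_deformation_def)
    \<comment> \<open>With two binary cochains the sign is (-1)^9 = -1, so the vanishing bracket
      says that \<open>?C\<close> equals its own negative. The coefficient of t carries this over to
      \<open>L\<close>.\<close>
    then have "?C = scale_fps (scaleL R) (- 1) ?C"
      by (simp add: cochain_bracket_def)
    then have "fps_nth ?C 1 = fps_nth (scale_fps (scaleL R) (- 1) ?C) 1"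
      by (rule arg_cong)
    then have "fps_nth ?C 1 = - fps_nth ?C 1"
      by (simp only: scale_fps_def fps_nth_Abs_fps L.scale_minus_left L.scale_one)
    moreover have "fps_nth ?C 1 = ?P"
      by (simp add: circ_series_bracket_const[OF assms(1) True])
    ultimately have "?P + ?P = 0"
      by (simp only: eq_neg_iff_add_eq_0)
    then have "scaleL R 2 ?P = 0"
      using L.scale_left_distrib[of 1 1 ?P] by simp
    then have "?P = 0"
      using assms(2) by (simp only: L.scale_eq_0_iff) simp
    \<comment> \<open>By the same sign, \<open>?P\<close> is the differential of
      \<open>m 1\<close>.\<close>
    then show ?thesis
      by (simp add: def_differential_def cochain_bracket_def m0 L.scale_minus_left)
  qed
  with m1 show ?thesis by (auto simp: def_cocycles_def)
qed

section \<open>The first-order part of a formal automorphism\<close>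

lemma act_fps_const: "act_fps R (fps_const a) (fps_const x) = fps_const (act R a x)"
proof (rule fps_ext)
  fix n
  have "(\<Sum>i\<le>n. act R (fps_nth (fps_const a) i) (fps_nth (fps_const x) (n - i))) =
      (\<Sum>i\<le>n. if i = 0 then act R a (fps_nth (fps_const x) n) else 0)"
    by (rule sum.cong) (auto simp: act_0_left)
  then show "fps_nth (act_fps R (fps_const a) (fps_const x)) n = fps_nth (fps_const (act R a x)) n"
    by (simp add: act_fps_def act_0_right)
qed

lemma formal_automorphism_at_0:
  assumes "formal_automorphism R \<phi>"
  shows "\<phi> i 0 = 0"
proof (cases i)
  case 0
  with assms show ?thesis by (simp add: formal_automorphism_def)
next
  case (Suc k)
  with assms have "Vector_Spaces.linear (scaleL R) (scaleL R) (\<phi> i)"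
    by (simp add: formal_automorphism_def even_linear_def)
  then show ?thesis by (rule linear_at_0)
qed

lemma formal_automorphism_first_order:
  assumes "formal_automorphism R \<phi>"
  shows "(\<lambda>xs. if length xs = 1 then \<phi> 1 (xs ! 0) else 0) \<in> Der_LL R 0" (is "?D \<in> _")
proof -
  obtain \<psi> where \<psi>: "\<psi> 0 = id" "\<And>i. i \<ge> 1 \<Longrightarrow> even_linear (scaleA R) (grA R) (\<psi> i)"
    and mult: "\<And>\<alpha> \<beta>. series_map \<psi> (\<alpha> * \<beta>) = series_map \<psi> \<alpha> * series_map \<psi> \<beta>"
    and act: "\<And>\<alpha> X. series_map \<phi> (act_fps R \<alpha> X) = act_fps R (series_map \<psi> \<alpha>) (series_map \<phi> X)"
    using assms unfolding formal_automorphism_def by metis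
  have \<phi>: "\<phi> 0 = id" "even_linear (scaleL R) (grL R) (\<phi> 1)"
    using assms by (simp_all add: formal_automorphism_def)
  note \<phi>0 = formal_automorphism_at_0[OF assms]
  have \<psi>0: "\<psi> i 0 = 0" for i
    using \<psi>(1) \<psi>(2)[of i] linear_at_0 by (cases i) (auto simp: even_linear_def)
  have "fps_nth (series_map \<psi> (fps_const a * fps_const b)) 1 =
      fps_nth (series_map \<psi> (fps_const a) * series_map \<psi> (fps_const b)) 1" for a b
    by (simp only: mult)
  \<comment> \<open>The coefficient of t in a product of two series, with
    \<open>\<psi> 0 = id\<close>: multiplicativity becomes the Leibniz rule.\<close>
  then have mult1: "\<psi> 1 (a * b) = \<psi> 1 a * b + a * \<psi> 1 b" for a b
    by (simp add: series_map_const \<psi>0 fps_mult_nth \<psi>(1) add.commute)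
  have "fps_nth (series_map \<phi> (fps_const (act R a x))) 1 =
      fps_nth (act_fps R (series_map \<psi> (fps_const a)) (series_map \<phi> (fps_const x))) 1" for a x
    by (simp only: act flip: act_fps_const)
  then have act1: "\<phi> 1 (act R a x) = act R a (\<phi> 1 x) + act R (\<psi> 1 a) x" for a x
    by (simp add: series_map_const \<psi>0 \<phi>0 \<psi>(1) \<phi>(1) act_fps_def)
  \<comment> \<open>Both first-order maps are even, so every sign in the super Leibniz rule and in
    condition (2) is trivial.\<close>
  have ks: "ksign 0 = (1::'k)" by (simp add: ksign_def)
  have "\<psi> 1 \<in> superderivations (scaleA R) (grA R) 0"
    by (rule superderivationsI)
      (use \<psi>(2)[of 1] in \<open>auto simp: even_linear_def mult1[unfolded One_nat_def] ks image_subset_iff\<close>)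
  from DerI[OF this zero_superderivation] have "\<psi> 1 \<in> Der (scaleA R) (grA R)" by simp
  \<comment> \<open>For \<open>n = 0\<close> the symbol takes the empty list, so it is one
    derivation, and condition (2) is \<open>act1\<close>.\<close>
  then have "symbol_map 0 0 ?D (\<lambda>_. \<psi> 1)"
    by (auto simp: symbol_map_def multilinear_map_def homogeneous_list_def act1[unfolded One_nat_def] ks)
  moreover have "multilinear_map (scaleL R) (scaleL R) (0 + 1) ?D"
    using \<phi>(2) by (auto simp: multilinear_map_def even_linear_def length_Suc_conv)
  moreover have "?D xs \<in> grL R (0 + sum_list ds)"
    if "length xs = 0 + 1 \<and> homogeneous_list (grL R) ds xs" for ds xs
    using \<phi>(2) that
    by (auto simp: even_linear_def homogeneous_list_def length_Suc_conv list_all2_Cons2 image_subset_iff)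
  ultimately have "?D \<in> Der_LL_hom R 0 0"
    unfolding Der_LL_hom_iff by auto
  \<comment> \<open>The odd summand of \<open>?D\<close> is zero.\<close>
  from Der_LLI[OF this Der_LL_hom_zero] show ?thesis by simp
qed

section \<open>Equivalent deformations have cohomologous infinitesimals\<close>

lemma equivalent_deformations_first_order:
  assumes "is_deformation R m" "is_deformation R m'" "equivalent_deformations R m m'"
  shows "(\<lambda>xs. m' 1 xs - m 1 xs) \<in> def_coboundaries R 2"
proof -
  obtain \<phi> where \<phi>: "formal_automorphism R \<phi>"
    and eq: "\<And>X Y. series_map \<phi> (series_bracket m' [X, Y]) =
              series_bracket m [series_map \<phi> X, series_map \<phi> Y]"
    using assms(3) unfolding equivalent_deformations_def by metis
  have \<phi>': "\<phi> 0 = id" "even_linear (scaleL R) (grL R) (\<phi> 1)"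
    using \<phi> by (simp_all add: formal_automorphism_def)
  have m0: "m 0 [x, y] = lie R x y" "m' 0 [x, y] = lie R x y" for x y
    using assms(1,2) by (simp_all add: is_deformation_def lie_cochain_def)
  \<comment> \<open>\<open>\<phi> 1\<close> as a 1-cochain, normalised to vanish off singleton
    lists.\<close>
  let ?D = "\<lambda>xs. if length xs = 1 then \<phi> 1 (xs ! 0) else 0"
  have bracket: "m' 1 [x, y] - m 1 [x, y] = lie R (\<phi> 1 x) y + lie R x (\<phi> 1 y) - \<phi> 1 (lie R x y)"
    for x y
  proof -
    have "fps_nth (series_map \<phi> (series_bracket m' [fps_const x, fps_const y])) 1 =
        \<phi> 1 (lie R x y) + m' 1 [x, y]"
      by (simp add: series_bracket_const[OF assms(2)] series_map_def \<phi>'(1) m0)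
    \<comment> \<open>The factor t can come from either argument or from the bracket, whence three
      terms.\<close>
    moreover have "fps_nth (series_bracket m [series_map \<phi> (fps_const x), series_map \<phi> (fps_const y)]) 1 =
        lie R (\<phi> 1 x) y + lie R x (\<phi> 1 y) + m 1 [x, y]"
      by (simp add: series_map_const formal_automorphism_at_0[OF \<phi>] series_bracket_def \<phi>'(1) m0)
    ultimately have "\<phi> 1 (lie R x y) + m' 1 [x, y] = lie R (\<phi> 1 x) y + lie R x (\<phi> 1 y) + m 1 [x, y]"
      unfolding eq by simp
    then show ?thesis by (simp add: algebra_simps)
  qed
  have "m' 1 xs - m 1 xs = def_differential R 1 ?D xs" for xs
  proof (cases "length xs = 2")
    case True
    then obtain x y where xs: "xs = [x, y]"
      by (auto simp: length_Suc_conv numeral_2_eq_2)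
    have "def_differential R 1 ?D [x, y] = lie R (\<phi> 1 x) y + lie R x (\<phi> 1 y) - \<phi> 1 (lie R x y)"
      by (rule def_differential_unary) (use \<phi>'(2) in \<open>auto simp: even_linear_def\<close>)
    with bracket show ?thesis by (simp only: xs)
  next
    \<comment> \<open>Both sides vanish here: cochains by normalisation, and \<open>circ\<close> by
      its length test.\<close>
    case False
    have "m 1 \<in> Der_LL R 1" "m' 1 \<in> Der_LL R 1"
      using assms(1,2) by (simp_all add: is_deformation_def)
    then have "m 1 xs = 0" "m' 1 xs = 0"
      using False by (auto intro: Der_LL_eq_0(1))
    then show ?thesis
      using False by (simp add: def_differential_def cochain_bracket_def circ_def)
  qed
  then have "(\<lambda>xs. m' 1 xs - m 1 xs) = def_differential R 1 ?D" by (rule ext)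
  moreover have "?D \<in> def_cochains R 1"
    using formal_automorphism_first_order[OF \<phi>] by (simp add: def_cochains_def)
  ultimately show ?thesis
    unfolding def_coboundaries_def numeral_2_eq_2 by simp
qed

end

theorem theorem4p13:
  fixes R :: "('k::field_char_0, 'a::ring, 'l::ab_group_add) lr_data"
    and m m' :: "nat \<Rightarrow> 'l list \<Rightarrow> 'l"
  assumes "lie_rinehart_superalgebra R"
    and "is_deformation R m"
    and "is_deformation R m'"
    and "equivalent_deformations R m m'"
  shows "m 1 \<in> def_cocycles R 2 \<and> m' 1 \<in> def_cocycles R 2 \<and>
    cohomology_class R 2 (m 1) = cohomology_class R 2 (m' 1)"
proof -
  interpret lie_rinehart_superalgebra R by fact
  \<comment> \<open>Characteristic zero supplies the condition that 2 is nonzero.\<close>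
  have cocycles: "m 1 \<in> def_cocycles R 2" "m' 1 \<in> def_cocycles R 2"
    by (rule infinitesimal_cocycle; use assms(2,3) in simp)+
  with equivalent_deformations_first_order[OF assms(2-4)]
  \<comment> \<open>This order matches the difference \<open>m' 1 - m 1\<close>, which is the
    coboundary of \<open>\<phi> 1\<close>.\<close>
  have "(m' 1, m 1) \<in> cohomologous R 2"
    by (simp add: cohomologous_def)
  from equiv_class_eq[OF equiv_cohomologous this] cocycles show ?thesis
    by (simp add: cohomology_class_def)
qed

end
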